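(* The phase-expanded realizations of edge-entry DLSL systems are exactly (up to isomorphism) the entry-consistent path-fiber graph-respecting transducers. Moreover, the edge-entry parameters $d_i$ and $\rho(i,j)$ are reconstructed uniquely from the fiber lengths and designated entry states.
   Context: Visible graphs. $S$ is a finite set (visible states), $\Omega$ a finite input alphabet. For a directed graph $(S,E)$, $E\subseteq S\times S$, write $\mathrm{Out}(i)=\{j\in S:(i,j)\in E\}$. With a labeling $\ell:S\to\Sigma$ into a finite alphabet the graph is destination-labeled: each edge $(i,j)$ carries the label $\ell(j)$. It is self-looping if $(i,i)\in E$ for all $i\in S$. It is label-deterministic if for every $i\in S$, $a\in\Sigma$ there is at most one $j\in\mathrm{Out}(i)$ with $\ell(j)=a$. Put $\Sigma_i=\{\ell(j):j\in\mathrm{Out}(i)\}$ and, for $a\in\Sigma_i$, let $\delta(i,a)$ be the unique $j\in\mathrm{Out}(i)$ with $\ell(j)=a$. An edge-entry DLSL (destination-labeled self-looping) system is $\mathcal A=(S,E,\ell,s_0,d,\rho,(g_i)_{i\in S})$ where $(S,E,\ell)$ is destination-labeled, self-looping and label-deterministic, $s_0\in S$, $d_i\ge1$ is an integer for each $i\in S$, each $g_i:\Omega\to\Sigma_i$ is a map, and $\rho:E\to\mathbb N$ satisfies $0\le\rho(i,j)\le d_j-1$ for every edge $(i,j)\in E$. Its operational update on input $u\in\Omega$ is $(i,r)\mapsto(i,r-1)$ if $r>0$, and $(i,0)\mapsto(j,\rho(i,j))$ where $j=\delta(i,g_i(u))$. Its phase-expanded realization is the deterministic transducer with control states $\{(i,r):i\in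 S,\ 0\le r\le d_i-1\}$, initial state $(s_0,d_{s_0}-1)$, transitions given by the operational update, and visible labeling $\lambda(i,r)=i$; it emits the visible label of the successor state. A graph-respecting (labeled) transducer for a visible graph on $S$ (a directed graph, with out-neighborhoods $\mathrm{Out}(\cdot)$, not required to be self-looping) is a deterministic finite transducer $T=(Q,q_0,\Omega,S,\Delta,\lambda)$ with initial state $q_0$, $\Delta:Q\times\Omega\to Q$, $\lambda:Q\to S$ surjective, and $\lambda(\Delta(q,u))\in\mathrm{Out}(\lambda(q))$ for all $q\in Q$, $u\in\Omega$; it emits the visible label of the successor state. A state $q\in Q$ is forced-hold if there is $q'\in Q$ with $\lambda(q')=\lambda(q)$ and $\Delta(q,u)=q'$ for every $u\in\Omega$; then $\mathrm{hsucc}(q):=q'$. Otherwise $q$ is a decision state. For $i\in S$ let $\mathrm{Fib}(i)=\lambda^{-1}(i)$; the fiber hold graph $H_i$ has vertex set $\mathrm{Fib}(i)$ and an edge $q\to\mathrm{hsucc}(q)$ for each forced-hold $q\in\mathrm{Fib}(i)$. A graph-respecting transducer is entry-consistent path-fiber if every visible-state fiber is a directed simple hold path with a unique decision state (each $H_i$ is a directed simple path on all of $\mathrm{Fib}(i)$ whose terminal vertex $p_i$ is the unique decision state of the fiber) and, for every visible edge $(i,j)$, there exists a distinguished (designated) entry state $e_{ij}\in\mathrm{Fib}(j)$ such that every decision transition from the decision state of fiber $i$ into visible state $j$ lands in $e_{ij}$. The designated entry states are regarded as part of the transducer. In the reconstruction from an entry-consistent path-fiber transducer, $d_i=|\mathrm{Fib}(i)|$,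 $\rho(i,j)$ is the distance from $e_{ij}$ to $p_j$ along the path $H_j$, $\ell(i)=i$, $g_i(u)=\lambda(\Delta(p_i,u))$, and the visible edge set consists of the pairs $(i,j)$ with $\lambda(\Delta(p_i,u))=j$ for some $u\in\Omega$, together with all self-loops $(i,i)$. Isomorphism of such transducers: a bijection of control-state sets that sends initial state to initial state, commutes with the transition maps for every input symbol, and preserves visible labels.
   Formalization: The formal version requires that no visible state of the DLSL system selects its self-loop on every input, and that the transducer's initial state is the first vertex of its fiber's hold path; without these the equivalence fails. Other initial states: isomorphism ignoring initial state. *)

theory Defs
  imports Main
begin

section \<open>Visible graphs\<close>

definition Out :: "('s \<times> 's) set \<Rightarrow> 's \<Rightarrow> 's set" where
  "Out E i = {j. (i, j) \<in> E}"

definition self_looping :: "'s set \<Rightarrow> ('s \<times> 's) set \<Rightarrow> bool" where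
  "self_looping S E \<longleftrightarrow> (\<forall>i\<in>S. (i, i) \<in> E)"

definition label_deterministic ::
    "'s set \<Rightarrow> ('s \<times> 's) set \<Rightarrow> 'l set \<Rightarrow> ('s \<Rightarrow> 'l) \<Rightarrow> bool" where
  "label_deterministic S E \<Sigma> l \<longleftrightarrow>
     (\<forall>i\<in>S. \<forall>a\<in>\<Sigma>. \<forall>j\<in>Out E i. \<forall>k\<in>Out E i. l j = a \<and> l k = a \<longrightarrow> j = k)"

definition out_labels :: "('s \<times> 's) set \<Rightarrow> ('s \<Rightarrow> 'l) \<Rightarrow> 's \<Rightarrow> 'l set" where
  "out_labels E l i = l ` Out E i"

definition label_succ :: "('s \<times> 's) set \<Rightarrow> ('s \<Rightarrow> 'l) \<Rightarrow> 's \<Rightarrow> 'l \<Rightarrow> 's" where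
  "label_succ E l i a = (THE j. j \<in> Out E i \<and> l j = a)"


section \<open>Deterministic transducers\<close>

text \<open>All maps are total HOL functions of which only the values on the carriers matter. The emitted
  symbol of a transition is the visible label of its target, so it is not stored separately.\<close>

record ('q, 'u, 's) transducer =
  t_states :: "'q set"
  t_init :: 'q
  t_inputs :: "'u set"
  t_visible :: "'s set"
  t_step :: "'q \<Rightarrow> 'u \<Rightarrow> 'q"
  t_label :: "'q \<Rightarrow> 's"

definition graph_respecting :: "('s \<times> 's) set \<Rightarrow> ('q, 'u, 's) transducer \<Rightarrow> bool" where
  "graph_respecting E T \<longleftrightarrow>
     finite (t_visible T) \<and> finite (t_inputs T) \<and> E \<subseteq> t_visible T \<times> t_visible T \<and>
     finite (t_states T) \<and> t_init T \<in> t_states T \<and>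
     t_label T ` t_states T = t_visible T \<and>
     (\<forall>q\<in>t_states T. \<forall>u\<in>t_inputs T.
        t_step T q u \<in> t_states T \<and> t_label T (t_step T q u) \<in> Out E (t_label T q))"

text \<open>Isomorphism, first without the condition on initial states.\<close>

definition unpointed_iso ::
    "('q \<Rightarrow> 'r) \<Rightarrow> ('q, 'u, 's) transducer \<Rightarrow> ('r, 'u, 's) transducer \<Rightarrow> bool" where
  "unpointed_iso \<phi> T T' \<longleftrightarrow>
     t_inputs T = t_inputs T' \<and> t_visible T = t_visible T' \<and>
     bij_betw \<phi> (t_states T) (t_states T') \<and>
     (\<forall>q\<in>t_states T. \<forall>u\<in>t_inputs T. \<phi> (t_step T q u) = t_step T' (\<phi> q) u) \<and>
     (\<forall>q\<in>t_states T. t_label T' (\<phi> q) = t_label T q)"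

definition transducer_iso ::
    "('q \<Rightarrow> 'r) \<Rightarrow> ('q, 'u, 's) transducer \<Rightarrow> ('r, 'u, 's) transducer \<Rightarrow> bool" where
  "transducer_iso \<phi> T T' \<longleftrightarrow> unpointed_iso \<phi> T T' \<and> \<phi> (t_init T) = t_init T'"

definition isomorphic ::
    "('q, 'u, 's) transducer \<Rightarrow> ('r, 'u, 's) transducer \<Rightarrow> bool" where
  "isomorphic T T' \<longleftrightarrow> (\<exists>\<phi>. transducer_iso \<phi> T T')"


section \<open>Edge-entry DLSL systems and their phase-expanded realizations\<close>

record ('s, 'l, 'u) dlsl =
  d_visible :: "'s set"
  d_edges :: "('s \<times> 's) set"
  d_alphabet :: "'l set"
  d_label :: "'s \<Rightarrow> 'l"
  d_start :: 's
  d_dur :: "'s \<Rightarrow> nat"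
  d_entry :: "'s \<Rightarrow> 's \<Rightarrow> nat"
  d_inputs :: "'u set"
  d_sel :: "'s \<Rightarrow> 'u \<Rightarrow> 'l"

definition edge_entry_dlsl :: "('s, 'l, 'u) dlsl \<Rightarrow> bool" where
  "edge_entry_dlsl A \<longleftrightarrow>
     finite (d_visible A) \<and> finite (d_inputs A) \<and> finite (d_alphabet A) \<and>
     d_edges A \<subseteq> d_visible A \<times> d_visible A \<and>
     d_label A ` d_visible A \<subseteq> d_alphabet A \<and>
     self_looping (d_visible A) (d_edges A) \<and>
     label_deterministic (d_visible A) (d_edges A) (d_alphabet A) (d_label A) \<and>
     d_start A \<in> d_visible A \<and>
     (\<forall>i\<in>d_visible A. d_dur A i \<ge> 1) \<and>
     (\<forall>(i, j)\<in>d_edges A. d_entry A i j \<le> d_dur A j - 1) \<and>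
     (\<forall>i\<in>d_visible A. \<forall>u\<in>d_inputs A. d_sel A i u \<in> out_labels (d_edges A) (d_label A) i)"

definition dlsl_next :: "('s, 'l, 'u) dlsl \<Rightarrow> 's \<Rightarrow> 'u \<Rightarrow> 's" where
  "dlsl_next A i u = label_succ (d_edges A) (d_label A) i (d_sel A i u)"

fun dlsl_update :: "('s, 'l, 'u) dlsl \<Rightarrow> 's \<times> nat \<Rightarrow> 'u \<Rightarrow> 's \<times> nat" where
  "dlsl_update A (i, r) u =
     (if r > 0 then (i, r - 1) else (let j = dlsl_next A i u in (j, d_entry A i j)))"

definition realization :: "('s, 'l, 'u) dlsl \<Rightarrow> ('s \<times> nat, 'u, 's) transducer" where
  "realization A =
     \<lparr> t_states = {(i, r). i \<in> d_visible A \<and> r \<le> d_dur A i - 1},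
       t_init = (d_start A, d_dur A (d_start A) - 1),
       t_inputs = d_inputs A,
       t_visible = d_visible A,
       t_step = dlsl_update A,
       t_label = fst \<rparr>"

definition realization_entry :: "('s, 'l, 'u) dlsl \<Rightarrow> 's \<Rightarrow> 's \<Rightarrow> 's \<times> nat" where
  "realization_entry A i j = (j, d_entry A i j)"

text \<open>If some \<open>g\<^sub>i\<close> always selects the self-loop at \<open>i\<close>, then \<open>(i, 0)\<close> is itself forced-hold, the
  fiber of \<open>i\<close> has no decision state, and its hold graph contains a cycle. The realization is then
  not path-fiber; this predicate excludes exactly that degenerate case.\<close>

definition non_absorbing :: "('s, 'l, 'u) dlsl \<Rightarrow> bool" where
  "non_absorbing A \<longleftrightarrow> (\<forall>i\<in>d_visible A. \<exists>u\<in>d_inputs A. dlsl_next A i u \<noteq> i)"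


section \<open>Fibers, hold graphs, entry-consistent path-fiber transducers\<close>

definition holds_to :: "('q, 'u, 's) transducer \<Rightarrow> 'q \<Rightarrow> 'q \<Rightarrow> bool" where
  "holds_to T q q' \<longleftrightarrow>
     q' \<in> t_states T \<and> t_label T q' = t_label T q \<and> (\<forall>u\<in>t_inputs T. t_step T q u = q')"

definition forced_hold :: "('q, 'u, 's) transducer \<Rightarrow> 'q \<Rightarrow> bool" where
  "forced_hold T q \<longleftrightarrow> q \<in> t_states T \<and> (\<exists>q'. holds_to T q q')"

definition hsucc :: "('q, 'u, 's) transducer \<Rightarrow> 'q \<Rightarrow> 'q" where
  "hsucc T q = (THE q'. holds_to T q q')"

definition decision_state :: "('q, 'u, 's) transducer \<Rightarrow> 'q \<Rightarrow> bool" where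
  "decision_state T q \<longleftrightarrow> q \<in> t_states T \<and> \<not> forced_hold T q"

definition Fib :: "('q, 'u, 's) transducer \<Rightarrow> 's \<Rightarrow> 'q set" where
  "Fib T i = {q \<in> t_states T. t_label T q = i}"

text \<open>The hold graph of fiber \<open>i\<close> has vertex set \<open>Fib T i\<close> and the following arcs.\<close>

definition hold_arcs :: "('q, 'u, 's) transducer \<Rightarrow> 's \<Rightarrow> ('q \<times> 'q) set" where
  "hold_arcs T i = {(q, hsucc T q) | q. q \<in> Fib T i \<and> forced_hold T q}"

text \<open>The graph \<open>(V, R)\<close> is, as a whole, a directed simple path ending in \<open>t\<close>.\<close>

definition simple_path_graph :: "'v set \<Rightarrow> ('v \<times> 'v) set \<Rightarrow> 'v \<Rightarrow> bool" where
  "simple_path_graph V R t \<longleftrightarrow>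
     (\<exists>xs. xs \<noteq> [] \<and> distinct xs \<and> set xs = V \<and> last xs = t \<and>
           R = {(xs ! k, xs ! Suc k) | k. Suc k < length xs})"

definition path_fiber :: "('q, 'u, 's) transducer \<Rightarrow> bool" where
  "path_fiber T \<longleftrightarrow>
     (\<forall>i\<in>t_visible T. \<exists>p. simple_path_graph (Fib T i) (hold_arcs T i) p \<and>
        {q \<in> Fib T i. decision_state T q} = {p})"

definition the_decision :: "('q, 'u, 's) transducer \<Rightarrow> 's \<Rightarrow> 'q" where
  "the_decision T i = (THE p. p \<in> Fib T i \<and> decision_state T p)"

text \<open>The designated entry states are part of the data: \<open>e i j\<close> is designated for each visible edge
  \<open>(i, j)\<close>, also for edges that no transition uses.\<close>

definition entry_consistent ::
    "('s \<times> 's) set \<Rightarrow> ('q, 'u, 's) transducer \<Rightarrow> ('s \<Rightarrow> 's \<Rightarrow> 'q) \<Rightarrow> bool" where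
  "entry_consistent E T e \<longleftrightarrow>
     (\<forall>(i, j)\<in>E. e i j \<in> Fib T j \<and>
        (\<forall>u\<in>t_inputs T. t_label T (t_step T (the_decision T i) u) = j \<longrightarrow>
           t_step T (the_decision T i) u = e i j))"

definition ec_path_fiber ::
    "('s \<times> 's) set \<Rightarrow> ('q, 'u, 's) transducer \<Rightarrow> ('s \<Rightarrow> 's \<Rightarrow> 'q) \<Rightarrow> bool" where
  "ec_path_fiber E T e \<longleftrightarrow> graph_respecting E T \<and> path_fiber T \<and> entry_consistent E T e"

text \<open>A realization starts in phase \<open>d - 1\<close>, the first vertex of its fiber path. An isomorphism
  preserves initial states, so only transducers with the following property can be isomorphic to a
  path-fiber realization.\<close>

definition starts_at_fiber_head :: "('q, 'u, 's) transducer \<Rightarrow> bool" where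
  "starts_at_fiber_head T \<longleftrightarrow>
     (\<forall>q\<in>Fib T (t_label T (t_init T)). (q, t_init T) \<notin> hold_arcs T (t_label T (t_init T)))"


section \<open>Reconstruction\<close>

definition hold_dist :: "('q, 'u, 's) transducer \<Rightarrow> 's \<Rightarrow> 'q \<Rightarrow> 'q \<Rightarrow> nat" where
  "hold_dist T j q p = (LEAST n. (q, p) \<in> hold_arcs T j ^^ n)"

definition used_edges :: "('q, 'u, 's) transducer \<Rightarrow> ('s \<times> 's) set" where
  "used_edges T =
     {(i, t_label T (t_step T (the_decision T i) u)) | i u. i \<in> t_visible T \<and> u \<in> t_inputs T}"

text \<open>The reconstructed graph has all self-loops, whereas \<open>E\<close> may lack some. If \<open>(i, i) \<notin> E\<close>, then
  there is no hold transition in the fiber of \<open>i\<close>, so on path-fiber transducers that fiber is a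
  singleton and its only state serves as the entry state of the added self-loop.\<close>

definition entry_of ::
    "('s \<times> 's) set \<Rightarrow> ('q, 'u, 's) transducer \<Rightarrow> ('s \<Rightarrow> 's \<Rightarrow> 'q) \<Rightarrow> 's \<Rightarrow> 's \<Rightarrow> 'q" where
  "entry_of E T e i j = (if (i, j) \<in> E then e i j else the_decision T j)"

definition reconstruct ::
    "('s \<times> 's) set \<Rightarrow> ('q, 'u, 's) transducer \<Rightarrow> ('s \<Rightarrow> 's \<Rightarrow> 'q) \<Rightarrow> ('s, 's, 'u) dlsl" where
  "reconstruct E T e =
     \<lparr> d_visible = t_visible T,
       d_edges = used_edges T \<union> Id_on (t_visible T),
       d_alphabet = t_visible T,
       d_label = (\<lambda>i. i),
       d_start = t_label T (t_init T),
       d_dur = (\<lambda>i. card (Fib T i)),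
       d_entry = (\<lambda>i j. hold_dist T j (entry_of E T e i j) (the_decision T j)),
       d_inputs = t_inputs T,
       d_sel = (\<lambda>i u. t_label T (t_step T (the_decision T i) u)) \<rparr>"

end

theory Submission
  imports Defs
begin

text \<open>Along a fiber path the remaining phase \<open>r\<close> is the distance to the decision state, so a state of a
  path-fiber transducer is the same thing as a pair (visible state, distance to the decision state).
  Numbering each fiber by this distance gives the isomorphism with the realization of the
  reconstruction. Conversely a hold graph is functional and a decision state has no outgoing arc,
  so isomorphisms preserve these distances, which makes the parameters unique.\<close>

section \<open>Hold graphs\<close>

text \<open>Three degenerate situations shape the statements. Over an empty input alphabet every
  state is vacuously forced-hold and \<open>hsucc\<close> is not determined by
  \<open>holds_to\<close>; the existence of a decision state rules this out. A transducer may start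
  anywhere in a fiber, whereas a realization always starts in the highest phase; transport and
  reconstruction are therefore carried out for \<open>unpointed_iso\<close>, and the initial state
  is treated by a separate equivalence. Finally, the value of \<open>d_entry\<close> on an edge
  taken by no decision transition leaves no trace in the steps of the realization, so on such edges
  uniqueness requires that the isomorphism itself match the designated entry states.\<close>

text \<open>The reversed list is indexed by the distance to the terminal vertex, so an index can
  serve directly as a phase and each arc lowers it by one.\<close>

lemma simple_path_graph_countdown:
  "simple_path_graph V R t \<longleftrightarrow>
     (\<exists>ys. ys \<noteq> [] \<and> distinct ys \<and> set ys = V \<and> ys ! 0 = t \<and>
           R = {(ys ! Suc r, ys ! r) | r. Suc r < length ys})"
proof -
  have arcs: "{(xs ! k, xs ! Suc k) | k. Suc k < length xs} =
      {(rev xs ! Suc r, rev xs ! r) | r. Suc r < length (rev xs)}" for xs :: "'a list"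
  proof (intro equalityI subsetI)
    fix a assume "a \<in> {(xs ! k, xs ! Suc k) | k. Suc k < length xs}"
    then obtain k where k: "Suc k < length xs" "a = (xs ! k, xs ! Suc k)" by blast
    \<comment> \<open>Reversal sends position \<open>Suc k\<close> to this index; the subtractions
      do not truncate because \<open>Suc k < length xs\<close>.\<close>
    define r where "r = length xs - 2 - k"
    have "length xs - Suc (Suc r) = k" "length xs - Suc r = Suc k" "Suc r < length xs"
      using k(1) by (auto simp: r_def)
    then have "a = (rev xs ! Suc r, rev xs ! r)" "Suc r < length (rev xs)"
      using k(2) by (auto simp: rev_nth)
    then show "a \<in> {(rev xs ! Suc r, rev xs ! r) | r. Suc r < length (rev xs)}" by blast
  next
    fix a assume "a \<in> {(rev xs ! Suc r, rev xs ! r) | r. Suc r < length (rev xs)}"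
    then obtain r where r: "Suc r < length xs" "a = (rev xs ! Suc r, rev xs ! r)" by auto
    define k where "k = length xs - Suc (Suc r)"
    have "length xs - Suc r = Suc k" "Suc k < length xs" using r(1) by (auto simp: k_def)
    then have "a = (xs ! k, xs ! Suc k)" using r by (simp add: rev_nth k_def)
    with \<open>Suc k < length xs\<close> show "a \<in> {(xs ! k, xs ! Suc k) | k. Suc k < length xs}" by blast
  qed
  show ?thesis
  proof
    assume "simple_path_graph V R t"
    then obtain xs where xs: "xs \<noteq> []" "distinct xs" "set xs = V" "last xs = t"
      "R = {(xs ! k, xs ! Suc k) | k. Suc k < length xs}"
      unfolding simple_path_graph_def by blast
    have "rev xs ! 0 = t" using xs by (simp add: rev_nth last_conv_nth)
    then show "\<exists>ys. ys \<noteq> [] \<and> distinct ys \<and> set ys = V \<and> ys ! 0 = t \<and>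
        R = {(ys ! Suc r, ys ! r) | r. Suc r < length ys}"
      using xs arcs[of xs] by (intro exI[of _ "rev xs"]) simp
  next
    assume "\<exists>ys. ys \<noteq> [] \<and> distinct ys \<and> set ys = V \<and> ys ! 0 = t \<and>
        R = {(ys ! Suc r, ys ! r) | r. Suc r < length ys}"
    then obtain ys where ys: "ys \<noteq> []" "distinct ys" "set ys = V" "ys ! 0 = t"
      "R = {(ys ! Suc r, ys ! r) | r. Suc r < length ys}" by blast
    have "last (rev ys) = t" using ys by (simp add: last_rev hd_conv_nth)
    then show "simple_path_graph V R t"
      unfolding simple_path_graph_def using ys arcs[of "rev ys"]
      by (intro exI[of _ "rev ys"]) simp
  qed
qed

lemma simple_path_graph_image:
  assumes "simple_path_graph V R t" "inj_on \<phi> V"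
  shows "simple_path_graph (\<phi> ` V) (map_prod \<phi> \<phi> ` R) (\<phi> t)"
proof -
  obtain ys where ys: "ys \<noteq> []" "distinct ys" "set ys = V" "ys ! 0 = t"
    "R = {(ys ! Suc r, ys ! r) | r. Suc r < length ys}"
    using assms(1) unfolding simple_path_graph_countdown by blast
  have "map_prod \<phi> \<phi> ` R =
      {(map \<phi> ys ! Suc r, map \<phi> ys ! r) | r. Suc r < length (map \<phi> ys)}"
    unfolding ys(5) by (force simp: image_iff)
  then show ?thesis
    unfolding simple_path_graph_countdown using ys assms(2)
    by (intro exI[of _ "map \<phi> ys"]) (auto simp: distinct_map)
qed

text \<open>A single input symbol suffices: its transition from \<open>q\<close> leaves only one
  possible target. Over an empty alphabet the condition on transitions is vacuous and the
  description need not be unique.\<close>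

lemma hsucc_eq:
  assumes "t_inputs T \<noteq> {}" "holds_to T q q'"
  shows "hsucc T q = q'"
  using assms unfolding hsucc_def holds_to_def by (intro the_equality) auto

lemma hold_arcs_eq:
  assumes "t_inputs T \<noteq> {}"
  shows "hold_arcs T i = {(q, q'). q \<in> Fib T i \<and> holds_to T q q'}"
  using hsucc_eq[OF assms] unfolding hold_arcs_def forced_hold_def Fib_def by auto

section \<open>Walk lengths in functional relations and hold graphs\<close>

lemma relpow_chain:
  fixes f :: "nat \<Rightarrow> 'a"
  assumes "\<And>k. k < n \<Longrightarrow> (f (Suc k), f k) \<in> R"
  shows "(f n, f 0) \<in> R ^^ n"
  using assms
proof (induction n)
  case (Suc n)
  then show ?case using relpow_Suc_I2[of "f (Suc n)" "f n" R "f 0" n] by simp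
qed simp

text \<open>Two walks from \<open>q\<close> share their arcs as long as both continue, and neither
  can continue after reaching \<open>p\<close>.\<close>

lemma relpow_to_terminal_unique:
  assumes "single_valued R" "p \<notin> Domain R" "(q, p) \<in> R ^^ m" "(q, p) \<in> R ^^ n"
  shows "m = n"
  using assms(3,4)
proof (induction m arbitrary: q n)
  case 0
  have "n \<noteq> Suc k" for k
  proof
    assume "n = Suc k"
    then obtain q' where "(q, q') \<in> R" using 0(2) by (metis relpow_Suc_E2)
    then show False using 0(1) assms(2) by auto
  qed
  then show ?case by (cases n) auto
next
  case (Suc m)
  obtain q' where q': "(q, q') \<in> R" "(q', p) \<in> R ^^ m" using Suc.prems(1) by (rule relpow_Suc_E2)
  have "n \<noteq> 0"
  proof
    assume "n = 0"
    then show False using Suc.prems(2) q'(1) assms(2) by auto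
  qed
  then obtain n' where n: "n = Suc n'" by (cases n) simp_all
  obtain q'' where "(q, q'') \<in> R" "(q'', p) \<in> R ^^ n'"
    using Suc.prems(2) unfolding n by (rule relpow_Suc_E2)
  with q' assms(1) have "(q', p) \<in> R ^^ n'" by (metis single_valuedD)
  with Suc.IH q'(2) n show ?case by blast
qed

text \<open>Only one walk length to a decision state is possible, so exhibiting any walk already
  computes the least one.\<close>

lemma hold_dist_eqI:
  assumes "decision_state T p" "(q, p) \<in> hold_arcs T j ^^ n"
  shows "hold_dist T j q p = n"
proof -
  have R: "single_valued (hold_arcs T j)" "p \<notin> Domain (hold_arcs T j)"
    using assms(1) unfolding hold_arcs_def single_valued_def decision_state_def by blast+
  show ?thesis
    unfolding hold_dist_def
  proof (rule Least_equality)
    show "(q, p) \<in> hold_arcs T j ^^ n" by (rule assms(2))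
    show "n \<le> m" if "(q, p) \<in> hold_arcs T j ^^ m" for m
      using relpow_to_terminal_unique[OF R assms(2) that] by simp
  qed
qed

section \<open>Decision states and countdown lists of path-fiber transducers\<close>

text \<open>Without input symbols every state would hold to itself, but the fiber of the initial
  state must contain a decision state.\<close>

lemma path_fiber_inputs_nonempty:
  assumes "graph_respecting E T" "path_fiber T"
  shows "t_inputs T \<noteq> {}"
proof
  assume empty: "t_inputs T = {}"
  have "t_label T (t_init T) \<in> t_visible T"
    using assms(1) unfolding graph_respecting_def by auto
  then obtain p where "p \<in> Fib T (t_label T (t_init T))" "decision_state T p"
    using assms(2) unfolding path_fiber_def by blast
  then show False using empty
    unfolding decision_state_def forced_hold_def holds_to_def Fib_def by auto
qed

lemma entry_consistentD:
  assumes "entry_consistent E T e" "(i, j) \<in> E"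
  shows "e i j \<in> Fib T j"
    "\<And>u. u \<in> t_inputs T \<Longrightarrow> t_label T (t_step T (the_decision T i) u) = j \<Longrightarrow>
      t_step T (the_decision T i) u = e i j"
  using bspec[OF assms(1)[unfolded entry_consistent_def] assms(2)] by simp_all

lemma the_decision_eq:
  assumes "{q \<in> Fib T i. decision_state T q} = {p}"
  shows "the_decision T i = p"
  unfolding the_decision_def using assms by (intro the_equality) auto

lemma path_fiber_countdown:
  assumes "path_fiber T" "i \<in> t_visible T"
  obtains ys where "ys \<noteq> []" "distinct ys" "set ys = Fib T i" "ys ! 0 = the_decision T i"
    "hold_arcs T i = {(ys ! Suc r, ys ! r) | r. Suc r < length ys}"
proof -
  obtain p where p: "simple_path_graph (Fib T i) (hold_arcs T i) p"
    "{q \<in> Fib T i. decision_state T q} = {p}"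
    using assms unfolding path_fiber_def by blast
  with that show ?thesis
    unfolding simple_path_graph_countdown the_decision_eq[OF p(2)] by blast
qed

lemma path_fiber_decisions:
  assumes "path_fiber T" "i \<in> t_visible T"
  shows "{q \<in> Fib T i. decision_state T q} = {the_decision T i}"
proof -
  obtain p where p: "{q \<in> Fib T i. decision_state T q} = {p}"
    using assms unfolding path_fiber_def by blast
  then show ?thesis unfolding the_decision_eq[OF p] .
qed

lemma path_fiber_the_decision:
  assumes "path_fiber T" "i \<in> t_visible T"
  shows "the_decision T i \<in> Fib T i" "decision_state T (the_decision T i)"
  using path_fiber_decisions[OF assms] by auto

section \<open>Transport along isomorphisms\<close>

lemma unpointed_isoD:
  assumes "unpointed_iso \<phi> T T'"
  shows "t_inputs T' = t_inputs T" "t_visible T' = t_visible T"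
    "t_states T' = \<phi> ` t_states T" "inj_on \<phi> (t_states T)"
    "\<And>q u. q \<in> t_states T \<Longrightarrow> u \<in> t_inputs T \<Longrightarrow> t_step T' (\<phi> q) u = \<phi> (t_step T q u)"
    "\<And>q. q \<in> t_states T \<Longrightarrow> t_label T' (\<phi> q) = t_label T q"
  using assms unfolding unpointed_iso_def bij_betw_def by simp_all

lemma unpointed_iso_Fib:
  assumes "unpointed_iso \<phi> T T'"
  shows "Fib T' i = \<phi> ` Fib T i"
  unfolding Fib_def unpointed_isoD(3)[OF assms] using unpointed_isoD(6)[OF assms] by auto

text \<open>Steps from \<open>q\<close> stay among the states, where \<phi> is injective, so
  equality of targets can be pushed forward and pulled back.\<close>

lemma unpointed_iso_holds_to:
  assumes iso: "unpointed_iso \<phi> T T'" and E: "graph_respecting E T"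
    and q: "q \<in> t_states T" "q' \<in> t_states T"
  shows "holds_to T' (\<phi> q) (\<phi> q') \<longleftrightarrow> holds_to T q q'"
proof -
  note I = unpointed_isoD[OF iso]
  have "t_step T' (\<phi> q) u = \<phi> q' \<longleftrightarrow> t_step T q u = q'" if "u \<in> t_inputs T" for u
  proof -
    have "t_step T q u \<in> t_states T" using E q that unfolding graph_respecting_def by blast
    then show ?thesis using I(4) I(5)[OF q(1) that] q by (simp add: inj_on_eq_iff)
  qed
  then have "(\<forall>u\<in>t_inputs T. t_step T' (\<phi> q) u = \<phi> q') \<longleftrightarrow> (\<forall>u\<in>t_inputs T. t_step T q u = q')"
    by blast
  then show ?thesis unfolding holds_to_def I(1,3) I(6)[OF q(1)] I(6)[OF q(2)] using q by blast
qed

lemma unpointed_iso_decision_state: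
  assumes iso: "unpointed_iso \<phi> T T'" and E: "graph_respecting E T"
    and q: "q \<in> t_states T"
  shows "decision_state T' (\<phi> q) \<longleftrightarrow> decision_state T q"
proof -
  have st: "t_states T' = \<phi> ` t_states T" by (rule unpointed_isoD(3)[OF iso])
  have "(\<exists>r. holds_to T' (\<phi> q) r) \<longleftrightarrow> (\<exists>q'. holds_to T q q')"
  proof
    assume "\<exists>r. holds_to T' (\<phi> q) r"
    then obtain r where r: "holds_to T' (\<phi> q) r" by blast
    \<comment> \<open>A hold target is a state by definition, hence has a preimage.\<close>
    then have "r \<in> \<phi> ` t_states T" unfolding holds_to_def st by simp
    with r obtain q' where "q' \<in> t_states T" "holds_to T' (\<phi> q) (\<phi> q')" by blast
    then show "\<exists>q'. holds_to T q q'" using unpointed_iso_holds_to[OF iso E q] by blast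
  next
    assume "\<exists>q'. holds_to T q q'"
    then obtain q' where "q' \<in> t_states T" "holds_to T q q'" unfolding holds_to_def by blast
    then show "\<exists>r. holds_to T' (\<phi> q) r" using unpointed_iso_holds_to[OF iso E q] by blast
  qed
  moreover have "\<phi> q \<in> t_states T'" unfolding st using q by (rule imageI)
  ultimately show ?thesis using q unfolding decision_state_def forced_hold_def by simp
qed

lemma unpointed_iso_hold_arcs:
  assumes iso: "unpointed_iso \<phi> T T'" and E: "graph_respecting E T" and "t_inputs T \<noteq> {}"
  shows "hold_arcs T' i = map_prod \<phi> \<phi> ` hold_arcs T i"
proof -
  have ne': "t_inputs T' \<noteq> {}" using assms(3) unpointed_isoD(1)[OF iso] by simp
  have st: "t_states T' = \<phi> ` t_states T" by (rule unpointed_isoD(3)[OF iso])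
  have sub: "q \<in> Fib T i \<Longrightarrow> q \<in> t_states T" for q unfolding Fib_def by simp
  have tgt: "holds_to T q q' \<Longrightarrow> q' \<in> t_states T" for q q' unfolding holds_to_def by simp
  have tgt': "holds_to T' q q' \<Longrightarrow> q' \<in> \<phi> ` t_states T" for q q'
    unfolding holds_to_def st by simp
  show ?thesis
    unfolding hold_arcs_eq[OF ne'] hold_arcs_eq[OF assms(3)] unpointed_iso_Fib[OF iso]
  proof (intro equalityI subsetI)
    fix a assume "a \<in> {(q, q'). q \<in> \<phi> ` Fib T i \<and> holds_to T' q q'}"
    then obtain q q' where q: "a = (\<phi> q, \<phi> q')" "q \<in> Fib T i" "q' \<in> t_states T"
      "holds_to T' (\<phi> q) (\<phi> q')" using tgt' by blast
    then have "holds_to T q q'" using unpointed_iso_holds_to[OF iso E] sub by blast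
    then show "a \<in> map_prod \<phi> \<phi> ` {(q, q'). q \<in> Fib T i \<and> holds_to T q q'}"
      using q by (auto intro!: image_eqI[of _ _ "(q, q')"])
  next
    fix a assume "a \<in> map_prod \<phi> \<phi> ` {(q, q'). q \<in> Fib T i \<and> holds_to T q q'}"
    then show "a \<in> {(q, q'). q \<in> \<phi> ` Fib T i \<and> holds_to T' q q'}"
      using unpointed_iso_holds_to[OF iso E] sub tgt by auto
  qed
qed

lemma unpointed_iso_decisions:
  assumes iso: "unpointed_iso \<phi> T T'" and E: "graph_respecting E T"
  shows "{q \<in> Fib T' i. decision_state T' q} = \<phi> ` {q \<in> Fib T i. decision_state T q}"
  unfolding unpointed_iso_Fib[OF iso]
  using unpointed_iso_decision_state[OF iso E] by (auto simp: Fib_def)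

text \<open>The visible graph is kept and the designated entries are pushed forward along \<phi>. An
  unpointed isomorphism says nothing about the initial state, so its membership is a separate
  premise.\<close>

lemma unpointed_iso_ec_path_fiber:
  assumes iso: "unpointed_iso \<phi> T T'" and ec: "ec_path_fiber E T e"
    and init: "t_init T' \<in> t_states T'"
  shows "ec_path_fiber E T' (\<lambda>i j. \<phi> (e i j))"
proof -
  have E: "graph_respecting E T" and pf: "path_fiber T" and cons: "entry_consistent E T e"
    using ec unfolding ec_path_fiber_def by auto
  have ne: "t_inputs T \<noteq> {}" by (rule path_fiber_inputs_nonempty[OF E pf])
  note inp = unpointed_isoD(1)[OF iso] and vis = unpointed_isoD(2)[OF iso]
    and st = unpointed_isoD(3)[OF iso] and inj = unpointed_isoD(4)[OF iso]
    and lab = unpointed_isoD(6)[OF iso]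
  have step: "t_step T' (\<phi> q) u = \<phi> (t_step T q u)" "t_step T q u \<in> t_states T"
    if "q \<in> t_states T" "u \<in> t_inputs T" for q u
    using unpointed_isoD(5)[OF iso] E that unfolding graph_respecting_def by simp_all
  have lab_im: "t_label T' ` \<phi> ` t_states T = t_label T ` t_states T"
    unfolding image_image using lab by (intro image_cong) auto
  have dec: "the_decision T' i = \<phi> (the_decision T i)" if "i \<in> t_visible T" for i
    by (rule the_decision_eq)
      (simp add: unpointed_iso_decisions[OF iso E] path_fiber_decisions[OF pf that])
  have "graph_respecting E T'"
    using E init[unfolded st] step lab unfolding graph_respecting_def st inp vis lab_im by simp
  moreover have "path_fiber T'"
    unfolding path_fiber_def vis
  proof
    fix i assume "i \<in> t_visible T"
    then obtain p where p: "simple_path_graph (Fib T i) (hold_arcs T i) p"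
      "{q \<in> Fib T i. decision_state T q} = {p}" using pf unfolding path_fiber_def by blast
    have "inj_on \<phi> (Fib T i)" using inj by (rule inj_on_subset) (auto simp: Fib_def)
    then have "simple_path_graph (Fib T' i) (hold_arcs T' i) (\<phi> p)"
      unfolding unpointed_iso_Fib[OF iso] unpointed_iso_hold_arcs[OF iso E ne]
      by (rule simple_path_graph_image[OF p(1)])
    moreover have "{q \<in> Fib T' i. decision_state T' q} = {\<phi> p}"
      unfolding unpointed_iso_decisions[OF iso E] p(2) by simp
    ultimately show "\<exists>p. simple_path_graph (Fib T' i) (hold_arcs T' i) p \<and>
        {q \<in> Fib T' i. decision_state T' q} = {p}" by (intro exI conjI)
  qed
  moreover have "entry_consistent E T' (\<lambda>i j. \<phi> (e i j))"
    unfolding entry_consistent_def inp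
  proof (clarify, intro conjI ballI impI)
    fix i j assume ij: "(i, j) \<in> E"
    then have i: "i \<in> t_visible T" using E unfolding graph_respecting_def by auto
    have p: "the_decision T i \<in> t_states T"
      using path_fiber_the_decision(1)[OF pf i] unfolding Fib_def by simp
    show "\<phi> (e i j) \<in> Fib T' j"
      unfolding unpointed_iso_Fib[OF iso] by (rule imageI[OF entry_consistentD(1)[OF cons ij]])
    fix u assume u: "u \<in> t_inputs T" "t_label T' (t_step T' (the_decision T' i) u) = j"
    from u(2) have "t_label T (t_step T (the_decision T i) u) = j"
      unfolding dec[OF i] step(1)[OF p u(1)] lab[OF step(2)[OF p u(1)]] .
    then have "t_step T (the_decision T i) u = e i j"
      by (rule entry_consistentD(2)[OF cons ij u(1)])
    then show "t_step T' (the_decision T' i) u = \<phi> (e i j)"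
      using dec[OF i] step[OF p u(1)] by simp
  qed
  ultimately show ?thesis unfolding ec_path_fiber_def by blast
qed

lemma transducer_iso_starts_at_fiber_head:
  assumes iso: "transducer_iso \<phi> T T'" and E: "graph_respecting E T" and "t_inputs T \<noteq> {}"
    and head: "starts_at_fiber_head T"
  shows "starts_at_fiber_head T'"
proof -
  have u: "unpointed_iso \<phi> T T'" and init: "t_init T' = \<phi> (t_init T)"
    using iso unfolding transducer_iso_def by auto
  have t0: "t_init T \<in> t_states T" using E unfolding graph_respecting_def by simp
  have lab: "t_label T' (t_init T') = t_label T (t_init T)"
    unfolding init by (rule unpointed_isoD(6)[OF u t0])
  note inj = unpointed_isoD(4)[OF u]
  show ?thesis
    unfolding starts_at_fiber_head_def lab unpointed_iso_hold_arcs[OF u E assms(3)]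
  proof (intro ballI notI)
    fix q assume "(q, t_init T') \<in> map_prod \<phi> \<phi> ` hold_arcs T (t_label T (t_init T))"
    then obtain r r' where r: "(r, r') \<in> hold_arcs T (t_label T (t_init T))" "\<phi> r' = \<phi> (t_init T)"
      unfolding init by auto
    then have "r \<in> Fib T (t_label T (t_init T))" "r' \<in> t_states T"
      unfolding hold_arcs_eq[OF assms(3)] holds_to_def by auto
    moreover from this r t0 inj have "r' = t_init T" by (simp add: inj_on_eq_iff)
    ultimately show False using r(1) head unfolding starts_at_fiber_head_def by blast
  qed
qed

section \<open>Realizations\<close>

lemma realization_simps [simp]:
  "t_states (realization A) = {(i, r). i \<in> d_visible A \<and> r \<le> d_dur A i - 1}"
  "t_init (realization A) = (d_start A, d_dur A (d_start A) - 1)"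
  "t_inputs (realization A) = d_inputs A"
  "t_visible (realization A) = d_visible A"
  "t_step (realization A) = dlsl_update A"
  "t_label (realization A) = fst"
  unfolding realization_def by simp_all

text \<open>The selected label lies in \<open>out_labels\<close>, which yields a successor carrying
  it; label determinism makes this the only one, so the description in \<open>label_succ\<close> is
  well defined.\<close>

lemma dlsl_next_edge:
  assumes A: "edge_entry_dlsl A" and i: "i \<in> d_visible A" and u: "u \<in> d_inputs A"
  shows "(i, dlsl_next A i u) \<in> d_edges A"
proof -
  have "d_sel A i u \<in> d_label A ` Out (d_edges A) i"
    using assms unfolding edge_entry_dlsl_def out_labels_def by blast
  then obtain j where j: "j \<in> Out (d_edges A) i" "d_label A j = d_sel A i u" by auto
  \<comment> \<open>Determinism speaks only of labels in the alphabet, so the selected label has to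
    be placed there.\<close>
  have "j \<in> d_visible A" using j(1) A unfolding edge_entry_dlsl_def Out_def by blast
  then have al: "d_sel A i u \<in> d_alphabet A" using A j(2) unfolding edge_entry_dlsl_def by auto
  have "label_succ (d_edges A) (d_label A) i (d_sel A i u) = j"
    unfolding label_succ_def
  proof (rule the_equality)
    show "j \<in> Out (d_edges A) i \<and> d_label A j = d_sel A i u" using j by simp
    have "label_deterministic (d_visible A) (d_edges A) (d_alphabet A) (d_label A)"
      using A unfolding edge_entry_dlsl_def by blast
    then show "\<And>k. k \<in> Out (d_edges A) i \<and> d_label A k = d_sel A i u \<Longrightarrow> k = j"
      using j i al unfolding label_deterministic_def by blast
  qed
  then show ?thesis using j unfolding dlsl_next_def Out_def by simp
qed

lemma edge_entry_dlslD:
  assumes "edge_entry_dlsl A"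
  shows "\<And>i j. (i, j) \<in> d_edges A \<Longrightarrow> i \<in> d_visible A"
    "\<And>i j. (i, j) \<in> d_edges A \<Longrightarrow> j \<in> d_visible A"
    "\<And>i. i \<in> d_visible A \<Longrightarrow> (i, i) \<in> d_edges A"
    "\<And>i. i \<in> d_visible A \<Longrightarrow> 1 \<le> d_dur A i"
    "\<And>i j. (i, j) \<in> d_edges A \<Longrightarrow> d_entry A i j \<le> d_dur A j - 1"
    "d_start A \<in> d_visible A"
  using assms unfolding edge_entry_dlsl_def self_looping_def by auto

text \<open>A countdown step uses the self-loop at \<open>i\<close>; a jump follows an edge, and the
  bound on \<open>d_entry\<close> keeps its phase inside the new fiber.\<close>

lemma graph_respecting_realization:
  assumes A: "edge_entry_dlsl A"
  shows "graph_respecting (d_edges A) (realization A)"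
proof -
  have fin: "finite (d_visible A)" "finite (d_inputs A)" "d_edges A \<subseteq> d_visible A \<times> d_visible A"
    using A unfolding edge_entry_dlsl_def by auto
  have "{(i, r). i \<in> d_visible A \<and> r \<le> d_dur A i - 1} = Sigma (d_visible A) (\<lambda>i. {..d_dur A i - 1})"
    by auto
  then have "finite {(i, r). i \<in> d_visible A \<and> r \<le> d_dur A i - 1}" using fin(1) by simp
  moreover have "fst ` {(i, r). i \<in> d_visible A \<and> r \<le> d_dur A i - 1} = d_visible A"
    by (force simp: image_iff)
  moreover have "dlsl_update A q u \<in> {(i, r). i \<in> d_visible A \<and> r \<le> d_dur A i - 1} \<and>
      fst (dlsl_update A q u) \<in> Out (d_edges A) (fst q)"
    if q_in: "q \<in> {(i, r). i \<in> d_visible A \<and> r \<le> d_dur A i - 1}" and u: "u \<in> d_inputs A"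
    for q u
  proof -
    obtain i r where q: "q = (i, r)" "i \<in> d_visible A" "r \<le> d_dur A i - 1"
      using q_in by (cases q) auto
    have next_edge: "(i, dlsl_next A i u) \<in> d_edges A" by (rule dlsl_next_edge[OF A q(2) u])
    show ?thesis
      using q edge_entry_dlslD(2,5)[OF A next_edge] edge_entry_dlslD(3)[OF A q(2)] next_edge
      by (auto simp: Let_def Out_def)
  qed
  ultimately show ?thesis
    using fin edge_entry_dlslD(6)[OF A] unfolding graph_respecting_def realization_simps by auto
qed

lemma realization_Fib:
  assumes "i \<in> d_visible A"
  shows "Fib (realization A) i = Pair i ` {..d_dur A i - 1}"
  using assms unfolding Fib_def by auto

lemma realization_holds_to_pred:
  assumes "i \<in> d_visible A" "Suc r \<le> d_dur A i - 1"
  shows "holds_to (realization A) (i, Suc r) (i, r)"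
  using assms unfolding holds_to_def by simp

text \<open>A positive phase always counts down. Phase 0 fails to decide exactly if all inputs
  select \<open>i\<close>: they then share the target \<open>(i, d_entry A i i)\<close>, whose phase
  is in range because the self-loop is an edge.\<close>

lemma realization_decision_state:
  assumes A: "edge_entry_dlsl A" and i: "i \<in> d_visible A"
    and r: "r \<le> d_dur A i - 1"
  shows "decision_state (realization A) (i, r) \<longleftrightarrow> r = 0 \<and> (\<exists>u\<in>d_inputs A. dlsl_next A i u \<noteq> i)"
proof (cases r)
  case 0
  have "(\<exists>q'. holds_to (realization A) (i, 0) q') \<longleftrightarrow> (\<forall>u\<in>d_inputs A. dlsl_next A i u = i)"
  proof
    assume "\<exists>q'. holds_to (realization A) (i, 0) q'"
    then show "\<forall>u\<in>d_inputs A. dlsl_next A i u = i"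
      by (auto simp: holds_to_def Let_def)
  next
    assume "\<forall>u\<in>d_inputs A. dlsl_next A i u = i"
    then have "holds_to (realization A) (i, 0) (i, d_entry A i i)"
      using edge_entry_dlslD(3,5)[OF A] i by (auto simp: holds_to_def Let_def)
    then show "\<exists>q'. holds_to (realization A) (i, 0) q'" by blast
  qed
  then show ?thesis using i unfolding 0 decision_state_def forced_hold_def by auto
next
  case (Suc k)
  then show ?thesis using realization_holds_to_pred[of i A k] i r
    unfolding decision_state_def forced_hold_def by auto
qed

text \<open>Non-absorption excludes an arc out of phase 0, which would close a cycle with the
  countdown.\<close>

lemma realization_hold_arcs:
  assumes A: "edge_entry_dlsl A" and na: "non_absorbing A" and i: "i \<in> d_visible A"
  shows "hold_arcs (realization A) i = {((i, Suc r), (i, r)) | r. Suc r < d_dur A i}"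
proof -
  have ne: "t_inputs (realization A) \<noteq> {}" using na i unfolding non_absorbing_def by auto
  have z: "\<not> holds_to (realization A) (i, 0) q'" for q'
    using realization_decision_state[OF A i, of 0] na i
    unfolding non_absorbing_def decision_state_def forced_hold_def by (cases q') auto
  have s: "holds_to (realization A) (i, Suc r) q' \<longleftrightarrow> q' = (i, r)" if "Suc r < d_dur A i" for r q'
    using realization_holds_to_pred[of i A r] hsucc_eq[OF ne] i that
    by (metis One_nat_def Suc_leI Suc_diff_1 less_Suc_eq_le not_less0 gr0I)
  \<comment> \<open>Positivity of the duration matters here: with truncated subtraction the left
    side would admit phase 0 even for duration 0.\<close>
  have lt: "r \<le> d_dur A i - 1 \<longleftrightarrow> r < d_dur A i" for r
    using edge_entry_dlslD(4)[OF A i] by auto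
  show ?thesis
    unfolding hold_arcs_eq[OF ne] realization_Fib[OF i]
  proof (intro equalityI subsetI)
    fix a assume "a \<in> {(q, q'). q \<in> Pair i ` {..d_dur A i - 1} \<and> holds_to (realization A) q q'}"
    then obtain k q' where "a = ((i, k), q')" "k < d_dur A i" "holds_to (realization A) (i, k) q'"
      using lt by auto
    then show "a \<in> {((i, Suc r), (i, r)) | r. Suc r < d_dur A i}"
      using z s by (cases k) auto
  next
    fix a assume "a \<in> {((i, Suc r), (i, r)) | r. Suc r < d_dur A i}"
    then show "a \<in> {(q, q'). q \<in> Pair i ` {..d_dur A i - 1} \<and> holds_to (realization A) q q'}"
      using s lt by auto
  qed
qed

lemma realization_path_fiber_iff:
  assumes A: "edge_entry_dlsl A"
  shows "path_fiber (realization A) \<longleftrightarrow> non_absorbing A"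
proof
  assume pf: "path_fiber (realization A)"
  show "non_absorbing A" unfolding non_absorbing_def
  proof
    fix i assume i: "i \<in> d_visible A"
    then obtain p where "p \<in> Fib (realization A) i" "decision_state (realization A) p"
      using path_fiber_the_decision[OF pf, of i] by auto
    then show "\<exists>u\<in>d_inputs A. dlsl_next A i u \<noteq> i"
      using realization_decision_state[OF A i] realization_Fib[OF i] by auto
  qed
next
  assume na: "non_absorbing A"
  show "path_fiber (realization A)" unfolding path_fiber_def
  proof (intro ballI exI conjI)
    fix i assume "i \<in> t_visible (realization A)"
    then have i: "i \<in> d_visible A" by simp
    have d: "1 \<le> d_dur A i" by (rule edge_entry_dlslD(4)[OF A i])
    \<comment> \<open>Entry \<open>r\<close> of this list is the state with \<open>r\<close> hold
      steps left.\<close>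
    let ?ys = "map (Pair i) [0..<d_dur A i]"
    have "{..<d_dur A i} = {..d_dur A i - 1}" using d by auto
    then have fib: "set ?ys = Fib (realization A) i"
      unfolding realization_Fib[OF i] by (simp add: atLeast0LessThan)
    have "hold_arcs (realization A) i = {(?ys ! Suc r, ?ys ! r) | r. Suc r < length ?ys}"
      unfolding realization_hold_arcs[OF A na i] by (intro Collect_cong iff_exI) auto
    moreover have "?ys \<noteq> []" "?ys ! 0 = (i, 0)" using d by auto
    moreover have "distinct ?ys" by (simp add: distinct_map inj_on_def)
    ultimately show "simple_path_graph (Fib (realization A) i) (hold_arcs (realization A) i) (i, 0)"
      unfolding simple_path_graph_countdown using fib by blast
    show "{q \<in> Fib (realization A) i. decision_state (realization A) q} = {(i, 0)}"
      unfolding realization_Fib[OF i]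
      using realization_decision_state[OF A i] na i unfolding non_absorbing_def by auto
  qed
qed

lemma realization_the_decision:
  assumes A: "edge_entry_dlsl A" and na: "non_absorbing A" and i: "i \<in> d_visible A"
  shows "the_decision (realization A) i = (i, 0)"
  using realization_decision_state[OF A i] na i
  unfolding non_absorbing_def
  by (intro the_decision_eq) (auto simp: realization_Fib)

text \<open>Entry consistency is built into the update, whose jump takes its new phase from the edge
  alone. Non-absorption serves to identify the decision state with \<open>(i, 0)\<close>.\<close>

lemma realization_ec_path_fiber_iff:
  assumes A: "edge_entry_dlsl A"
  shows "ec_path_fiber (d_edges A) (realization A) (realization_entry A) \<longleftrightarrow> non_absorbing A"
proof -
  have "entry_consistent (d_edges A) (realization A) (realization_entry A)" if na: "non_absorbing A"
    unfolding entry_consistent_def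
  proof (clarify, intro conjI ballI impI)
    fix i j assume ij: "(i, j) \<in> d_edges A"
    note D = edge_entry_dlslD[OF A]
    show "realization_entry A i j \<in> Fib (realization A) j"
      using D(2,5)[OF ij] unfolding realization_entry_def Fib_def by auto
    fix u assume "t_label (realization A) (t_step (realization A) (the_decision (realization A) i) u) = j"
    then show "t_step (realization A) (the_decision (realization A) i) u = realization_entry A i j"
      unfolding realization_the_decision[OF A na D(1)[OF ij]] realization_entry_def
      by (auto simp: Let_def)
  qed
  then show ?thesis
    using realization_path_fiber_iff[OF A] graph_respecting_realization[OF A]
    unfolding ec_path_fiber_def by blast
qed

text \<open>An arc into phase \<open>d - 1\<close> would have to leave phase \<open>d\<close>, which
  is out of range.\<close>

lemma realization_starts_at_fiber_head:
  assumes "edge_entry_dlsl A" "non_absorbing A"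
  shows "starts_at_fiber_head (realization A)"
  using realization_hold_arcs[OF assms edge_entry_dlslD(6)[OF assms(1)]]
  unfolding starts_at_fiber_head_def by auto

section \<open>Reconstruction\<close>

lemma reconstruct_simps [simp]:
  "d_visible (reconstruct E T e) = t_visible T"
  "d_edges (reconstruct E T e) = used_edges T \<union> Id_on (t_visible T)"
  "d_alphabet (reconstruct E T e) = t_visible T"
  "d_label (reconstruct E T e) = (\<lambda>i. i)"
  "d_start (reconstruct E T e) = t_label T (t_init T)"
  "d_dur (reconstruct E T e) = (\<lambda>i. card (Fib T i))"
  "d_entry (reconstruct E T e) =
     (\<lambda>i j. hold_dist T j (entry_of E T e i j) (the_decision T j))"
  "d_inputs (reconstruct E T e) = t_inputs T"
  "d_sel (reconstruct E T e) = (\<lambda>i u. t_label T (t_step T (the_decision T i) u))"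
  unfolding reconstruct_def by simp_all

lemma used_edges_subset:
  assumes "graph_respecting E T" "path_fiber T"
  shows "used_edges T \<subseteq> E"
proof -
  have "t_label T (t_step T (the_decision T i) u) \<in> Out E i"
    if "i \<in> t_visible T" "u \<in> t_inputs T" for i u
    using path_fiber_the_decision(1)[OF assms(2) that(1)] assms(1) that(2)
    unfolding graph_respecting_def Fib_def by auto
  then show ?thesis unfolding used_edges_def Out_def by auto
qed

text \<open>Used edges lie in \<open>E\<close>, so an edge outside \<open>E\<close> is an added
  self-loop; there \<open>entry_of\<close> falls back on the decision state of the fiber.\<close>

lemma entry_of_in_Fib:
  assumes ec: "ec_path_fiber E T e" and ij: "(i, j) \<in> used_edges T \<union> Id_on (t_visible T)"
  shows "i \<in> t_visible T" "j \<in> t_visible T" "entry_of E T e i j \<in> Fib T j"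
proof -
  have E: "graph_respecting E T" and pf: "path_fiber T" and cons: "entry_consistent E T e"
    using ec unfolding ec_path_fiber_def by auto
  have "E \<subseteq> t_visible T \<times> t_visible T" using E unfolding graph_respecting_def by blast
  then show "i \<in> t_visible T" and j: "j \<in> t_visible T"
    using ij used_edges_subset[OF E pf] by auto
  show "entry_of E T e i j \<in> Fib T j"
    using entry_consistentD(1)[OF cons] path_fiber_the_decision(1)[OF pf j]
    unfolding entry_of_def by simp
qed

text \<open>The edge taken by a decision transition lies in \<open>E\<close>, so the default value
  of \<open>entry_of\<close> is not reached and entry consistency applies.\<close>

lemma decision_step:
  assumes ec: "ec_path_fiber E T e" and i: "i \<in> t_visible T" and u: "u \<in> t_inputs T"
  defines "j \<equiv> t_label T (t_step T (the_decision T i) u)"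
  shows "(i, j) \<in> used_edges T" "t_step T (the_decision T i) u = entry_of E T e i j"
proof -
  have E: "graph_respecting E T" and pf: "path_fiber T" and cons: "entry_consistent E T e"
    using ec unfolding ec_path_fiber_def by auto
  show used: "(i, j) \<in> used_edges T" using i u unfolding used_edges_def j_def by blast
  then have "(i, j) \<in> E" using used_edges_subset[OF E pf] by blast
  then show "t_step T (the_decision T i) u = entry_of E T e i j"
    using entry_consistentD(2)[OF cons _ u, of i j] unfolding entry_of_def j_def by simp
qed

lemma hold_dist_countdown:
  assumes pf: "path_fiber T" and j: "j \<in> t_visible T"
    and ys: "ys ! 0 = the_decision T j"
      "hold_arcs T j = {(ys ! Suc r, ys ! r) | r. Suc r < length ys}"
    and r: "r < length ys"
  shows "hold_dist T j (ys ! r) (the_decision T j) = r"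
proof (rule hold_dist_eqI)
  show "decision_state T (the_decision T j)" by (rule path_fiber_the_decision(2)[OF pf j])
  have "(ys ! r, ys ! 0) \<in> hold_arcs T j ^^ r"
    using r by (intro relpow_chain) (auto simp: ys(2))
  then show "(ys ! r, the_decision T j) \<in> hold_arcs T j ^^ r" using ys(1) by simp
qed

lemma reconstruct_next:
  assumes "i \<in> t_visible T" "u \<in> t_inputs T"
  shows "dlsl_next (reconstruct E T e) i u = t_label T (t_step T (the_decision T i) u)"
  using assms unfolding dlsl_next_def label_succ_def
  by (intro the_equality) (auto simp: Out_def used_edges_def)

lemma reconstruct_edge_entry_dlsl:
  assumes ec: "ec_path_fiber E T e"
  shows "edge_entry_dlsl (reconstruct E T e)"
proof -
  have E: "graph_respecting E T" and pf: "path_fiber T"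
    using ec unfolding ec_path_fiber_def by auto
  have fin: "finite (t_visible T)" "finite (t_inputs T)" "finite (t_states T)"
    "t_label T (t_init T) \<in> t_visible T"
    using E unfolding graph_respecting_def by auto
  have "\<forall>i\<in>t_visible T. 1 \<le> card (Fib T i)"
  proof
    fix i assume "i \<in> t_visible T"
    then have "the_decision T i \<in> Fib T i" by (rule path_fiber_the_decision(1)[OF pf])
    moreover have "finite (Fib T i)" using fin(3) unfolding Fib_def by simp
    ultimately show "1 \<le> card (Fib T i)" by (metis One_nat_def Suc_leI card_gt_0_iff empty_iff)
  qed
  moreover have "hold_dist T j (entry_of E T e i j) (the_decision T j) \<le> card (Fib T j) - 1"
    if ij: "(i, j) \<in> used_edges T \<union> Id_on (t_visible T)" for i j
  proof -
    note j = entry_of_in_Fib(2,3)[OF ec ij]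
    obtain ys where ys: "ys \<noteq> []" "distinct ys" "set ys = Fib T j" "ys ! 0 = the_decision T j"
      "hold_arcs T j = {(ys ! Suc r, ys ! r) | r. Suc r < length ys}"
      by (rule path_fiber_countdown[OF pf j(1)])
    \<comment> \<open>The position of the entry state in the countdown list is its distance, and the
      length of the list is the size of the fiber; this gives the bound.\<close>
    from j(2) ys(3) obtain r where r: "r < length ys" "entry_of E T e i j = ys ! r"
      by (metis in_set_conv_nth)
    have "card (Fib T j) = length ys" using ys(2,3) distinct_card by metis
    then show ?thesis using hold_dist_countdown[OF pf j(1) ys(4,5) r(1)] r by simp
  qed
  moreover have "used_edges T \<union> Id_on (t_visible T) \<subseteq> t_visible T \<times> t_visible T"
    using entry_of_in_Fib(1,2)[OF ec] by auto
  ultimately show ?thesis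
    using fin
    by (auto simp: edge_entry_dlsl_def self_looping_def label_deterministic_def out_labels_def
        Out_def used_edges_def)
qed

text \<open>If all decision transitions stayed in fiber \<open>i\<close>, they would all land in the single entry state
  of the self-loop, and the decision state would be forced-hold.\<close>

lemma reconstruct_non_absorbing:
  assumes ec: "ec_path_fiber E T e"
  shows "non_absorbing (reconstruct E T e)"
  unfolding non_absorbing_def reconstruct_simps
proof (intro ballI, rule ccontr)
  fix i assume i: "i \<in> t_visible T"
    and neg: "\<not> (\<exists>u\<in>t_inputs T. dlsl_next (reconstruct E T e) i u \<noteq> i)"
  have pf: "path_fiber T" using ec unfolding ec_path_fiber_def by auto
  have lab: "t_label T (t_step T (the_decision T i) u) = i" if "u \<in> t_inputs T" for u
    using neg that reconstruct_next[OF i that] by auto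
  note p = path_fiber_the_decision[OF pf i]
  have "entry_of E T e i i \<in> Fib T i" using entry_of_in_Fib(3)[OF ec, of i i] i by auto
  then have "holds_to T (the_decision T i) (entry_of E T e i i)"
    using decision_step(2)[OF ec i] lab p(1) unfolding holds_to_def Fib_def by auto
  then show False using p(2) unfolding decision_state_def forced_hold_def by blast
qed

section \<open>The isomorphism with the realization of the reconstruction\<close>

text \<open>Phase \<open>r\<close> of fiber \<open>i\<close> goes to position \<open>r\<close> of
  the countdown list of that fiber. Countdown steps become hold arcs, and a jump lands on the
  position recorded by \<open>d_entry\<close>.\<close>

lemma reconstruct_iso:
  assumes ec: "ec_path_fiber E T e"
  defines "A \<equiv> reconstruct E T e"
  shows "\<exists>\<phi>. unpointed_iso \<phi> (realization A) T \<and>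
    (\<forall>(i, j) \<in> d_edges A. \<phi> (realization_entry A i j) = entry_of E T e i j) \<and>
    (transducer_iso \<phi> (realization A) T \<longleftrightarrow> starts_at_fiber_head T)"
proof -
  have E: "graph_respecting E T" and pf: "path_fiber T"
    using ec unfolding ec_path_fiber_def by auto
  have ne: "t_inputs T \<noteq> {}" by (rule path_fiber_inputs_nonempty[OF E pf])
  have lab_st: "t_label T q \<in> t_visible T" if "q \<in> t_states T" for q
    using E that unfolding graph_respecting_def by auto
  \<comment> \<open>Bundling the five properties allows one simultaneous choice of lists
    \<open>Y\<close> for all visible states.\<close>
  define P where "P i ys \<longleftrightarrow> ys \<noteq> [] \<and> distinct ys \<and> set ys = Fib T i \<and>
    ys ! 0 = the_decision T i \<and> hold_arcs T i = {(ys ! Suc r, ys ! r) | r. Suc r < length ys}"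
    for i ys
  have "\<exists>ys. P i ys" if "i \<in> t_visible T" for i
    by (rule path_fiber_countdown[OF pf that], rule exI) (simp add: P_def)
  then obtain Y where PY: "\<And>i. i \<in> t_visible T \<Longrightarrow> P i (Y i)" by metis
  have Y: "Y i \<noteq> []" "distinct (Y i)" "set (Y i) = Fib T i" "Y i ! 0 = the_decision T i"
    "hold_arcs T i = {(Y i ! Suc r, Y i ! r) | r. Suc r < length (Y i)}"
    if "i \<in> t_visible T" for i
    using PY[OF that] unfolding P_def by simp_all
  have card: "card (Fib T i) = length (Y i)" if "i \<in> t_visible T" for i
    using Y(2,3)[OF that] distinct_card by metis
  have len: "r \<le> length (Y i) - 1 \<longleftrightarrow> r < length (Y i)" if "i \<in> t_visible T" for i r
    using Y(1)[OF that] by (cases "Y i") auto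
  define \<phi> where "\<phi> = (\<lambda>(i, r). Y i ! r)"
  have states: "t_states (realization A) = {(i, r). i \<in> t_visible T \<and> r < length (Y i)}"
    unfolding A_def using card len by auto
  have nth: "Y i ! r \<in> t_states T" "t_label T (Y i ! r) = i"
    if "i \<in> t_visible T" "r < length (Y i)" for i r
    using nth_mem[OF that(2)] unfolding Y(3)[OF that(1)] Fib_def by simp_all
  have entry: "\<phi> (realization_entry A i j) = entry_of E T e i j" if "(i, j) \<in> d_edges A" for i j
  proof -
    have ij: "(i, j) \<in> used_edges T \<union> Id_on (t_visible T)" using that unfolding A_def by simp
    note j = entry_of_in_Fib(2,3)[OF ec ij]
    obtain r where r: "r < length (Y j)" "entry_of E T e i j = Y j ! r"
      using j(2) Y(3)[OF j(1)] by (metis in_set_conv_nth)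
    show ?thesis using hold_dist_countdown[OF pf j(1) Y(4,5)[OF j(1)] r(1)] r(2)
      unfolding realization_entry_def \<phi>_def A_def by simp
  qed
  have step: "\<phi> (t_step (realization A) (i, r) u) = t_step T (\<phi> (i, r)) u"
    if "(i, r) \<in> t_states (realization A)" and u: "u \<in> t_inputs T" for i r u
  proof (cases r)
    case 0
    have i: "i \<in> t_visible T" using that unfolding states by simp
    let ?j = "t_label T (t_step T (the_decision T i) u)"
    have "t_step (realization A) (i, r) u = realization_entry A i ?j"
      using 0 reconstruct_next[OF i u] unfolding A_def realization_entry_def by (simp add: Let_def)
    moreover have "(i, ?j) \<in> d_edges A" using decision_step(1)[OF ec i u] unfolding A_def by simp
    ultimately show ?thesis
      using entry decision_step(2)[OF ec i u] Y(4)[OF i] 0 unfolding \<phi>_def by simp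
  next
    case (Suc k)
    have i: "i \<in> t_visible T" "Suc k < length (Y i)" using that Suc unfolding states by auto
    then have "(Y i ! Suc k, Y i ! k) \<in> hold_arcs T i" unfolding Y(5)[OF i(1)] by blast
    then have "t_step T (Y i ! Suc k) u = Y i ! k"
      using u unfolding hold_arcs_eq[OF ne] holds_to_def by blast
    then show ?thesis using Suc unfolding \<phi>_def by simp
  qed
  have "bij_betw \<phi> (t_states (realization A)) (t_states T)"
    unfolding bij_betw_def
  proof
    show "inj_on \<phi> (t_states (realization A))"
    proof (rule inj_onI, clarify)
      fix i r j k
      assume "(i, r) \<in> t_states (realization A)" "(j, k) \<in> t_states (realization A)"
        and eq: "\<phi> (i, r) = \<phi> (j, k)"
      then have *: "i \<in> t_visible T" "r < length (Y i)" "j \<in> t_visible T" "k < length (Y j)"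
        unfolding states by auto
      then have ij: "i = j" using nth(2) eq unfolding \<phi>_def by (metis case_prod_conv)
      then have "r = k" using * Y(2)[OF *(1)] eq nth_eq_iff_index_eq unfolding \<phi>_def by auto
      then show "i = j \<and> r = k" using ij by simp
    qed
    show "\<phi> ` t_states (realization A) = t_states T"
    proof (intro equalityI subsetI)
      fix q assume "q \<in> \<phi> ` t_states (realization A)"
      then show "q \<in> t_states T" unfolding states \<phi>_def using nth(1) by auto
    next
      fix q assume q: "q \<in> t_states T"
      let ?i = "t_label T q"
      have "q \<in> set (Y ?i)" using Y(3)[OF lab_st[OF q]] q unfolding Fib_def by simp
      then obtain r where "r < length (Y ?i)" "Y ?i ! r = q" by (metis in_set_conv_nth)
      then show "q \<in> \<phi> ` t_states (realization A)"
        unfolding states \<phi>_def using lab_st[OF q] by (intro image_eqI[of _ _ "(?i, r)"]) auto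
    qed
  qed
  moreover have "\<phi> (t_step (realization A) q u) = t_step T (\<phi> q) u"
    if "q \<in> t_states (realization A)" and u: "u \<in> t_inputs (realization A)" for q u
  proof -
    obtain i r where q: "q = (i, r)" by (cases q)
    have uT: "u \<in> t_inputs T" using u unfolding A_def by simp
    show ?thesis
      unfolding q by (rule step[OF that(1)[unfolded q] uT])
  qed
  moreover have "t_inputs (realization A) = t_inputs T" "t_visible (realization A) = t_visible T"
    unfolding A_def by simp_all
  moreover have "t_label T (\<phi> q) = t_label (realization A) q"
    if "q \<in> t_states (realization A)" for q
    using that nth(2) unfolding states \<phi>_def by auto
  ultimately have iso: "unpointed_iso \<phi> (realization A) T"
    unfolding unpointed_iso_def
    by (intro conjI ballI)
  \<comment> \<open>The realization starts at the last position \<open>?n\<close>. With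
    \<open>t_init T\<close> at position \<open>r\<close>, a hold predecessor exists exactly if
    \<open>Suc r\<close> is still an index, that is, if \<open>r \<noteq> ?n\<close>.\<close>
  have "\<phi> (t_init (realization A)) = t_init T \<longleftrightarrow> starts_at_fiber_head T"
  proof -
    let ?i = "t_label T (t_init T)"
    have t0: "t_init T \<in> t_states T" using E unfolding graph_respecting_def by simp
    note i = lab_st[OF t0]
    let ?n = "length (Y ?i) - 1"
    have ini: "\<phi> (t_init (realization A)) = Y ?i ! ?n"
      unfolding A_def \<phi>_def using card[OF i] by simp
    have "t_init T \<in> set (Y ?i)" using Y(3)[OF i] t0 unfolding Fib_def by simp
    then obtain r where r: "r < length (Y ?i)" "Y ?i ! r = t_init T" by (metis in_set_conv_nth)
    have n: "?n < length (Y ?i)" using r(1) by simp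
    have "starts_at_fiber_head T \<longleftrightarrow> (\<nexists>q. (q, t_init T) \<in> hold_arcs T ?i)"
      unfolding starts_at_fiber_head_def hold_arcs_eq[OF ne] by auto
    also have "\<dots> \<longleftrightarrow> (\<nexists>k. Suc k < length (Y ?i) \<and> Y ?i ! k = Y ?i ! r)"
      unfolding Y(5)[OF i] r(2) by auto
    also have "\<dots> \<longleftrightarrow> (\<nexists>k. Suc k < length (Y ?i) \<and> k = r)"
      using nth_eq_iff_index_eq[OF Y(2)[OF i]] r(1) by (metis Suc_lessD)
    also have "\<dots> \<longleftrightarrow> r = ?n" using r(1) by auto
    also have "\<dots> \<longleftrightarrow> Y ?i ! ?n = Y ?i ! r"
      using nth_eq_iff_index_eq[OF Y(2)[OF i] n r(1)] by auto
    finally show ?thesis unfolding ini r(2) by simp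
  qed
  then show ?thesis using iso entry unfolding transducer_iso_def by blast
qed

section \<open>Uniqueness of durations and entry phases\<close>

text \<open>Fiber sizes and hold distances are invariants of the steps and labels. On a used edge
  the decision transition itself reveals the entry state; on any other edge the match of designated
  entries is supplied by the premise.\<close>

lemma realization_iso_parameters:
  assumes ec: "ec_path_fiber E T e" and A: "edge_entry_dlsl A"
    and iso: "unpointed_iso \<phi> (realization A) T"
  shows "\<And>i. i \<in> t_visible T \<Longrightarrow> d_dur A i = card (Fib T i)"
    and "\<And>i j. (i, j) \<in> d_edges A \<Longrightarrow>
      (i, j) \<in> used_edges T \<or> \<phi> (realization_entry A i j) = entry_of E T e i j \<Longrightarrow>
      d_entry A i j = hold_dist T j (entry_of E T e i j) (the_decision T j)"
proof -
  have E: "graph_respecting E T" and pf: "path_fiber T"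
    using ec unfolding ec_path_fiber_def by auto
  have ne: "t_inputs T \<noteq> {}" by (rule path_fiber_inputs_nonempty[OF E pf])
  note G = graph_respecting_realization[OF A] and D = edge_entry_dlslD[OF A]
  have inp: "d_inputs A = t_inputs T" and vis: "d_visible A = t_visible T"
    using unpointed_isoD(1,2)[OF iso] by simp_all
  note inj = unpointed_isoD(4)[OF iso] and lab = unpointed_isoD(6)[OF iso]
    and step = unpointed_isoD(5)[OF iso]
  have neA: "t_inputs (realization A) \<noteq> {}" using ne inp by simp
  show "d_dur A i = card (Fib T i)" if "i \<in> t_visible T" for i
  proof -
    have i: "i \<in> d_visible A" using that vis by simp
    have "card (Fib T i) = card (Fib (realization A) i)"
      unfolding unpointed_iso_Fib[OF iso]
      using inj by (intro card_image) (rule inj_on_subset, auto simp: Fib_def)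
    also have "\<dots> = card {..d_dur A i - 1}"
      unfolding realization_Fib[OF i] by (intro card_image) (simp add: inj_on_def)
    also have "\<dots> = d_dur A i" using D(4)[OF i] by simp
    finally show ?thesis by simp
  qed
  \<comment> \<open>The preimage of the decision state of \<open>T\<close> is a decision state of
    the realization, and only phase 0 can be one.\<close>
  have dec: "the_decision T i = \<phi> (i, 0)" if "i \<in> d_visible A" for i
  proof -
    have "the_decision T i \<in> Fib T i" "decision_state T (the_decision T i)"
      using path_fiber_the_decision[OF pf] that vis by auto
    then have "the_decision T i \<in> \<phi> ` {q \<in> Fib (realization A) i. decision_state (realization A) q}"
      unfolding unpointed_iso_decisions[OF iso G, symmetric] by simp
    then show ?thesis using realization_decision_state[OF A that]
      unfolding realization_Fib[OF that] by auto
  qed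
  show "d_entry A i j = hold_dist T j (entry_of E T e i j) (the_decision T j)"
    if ij: "(i, j) \<in> d_edges A"
      and h: "(i, j) \<in> used_edges T \<or> \<phi> (realization_entry A i j) = entry_of E T e i j" for i j
  proof -
    have i: "i \<in> d_visible A" and j: "j \<in> d_visible A" and le: "d_entry A i j \<le> d_dur A j - 1"
      using D ij by auto
    have "\<phi> (realization_entry A i j) = entry_of E T e i j"
      if used: "(i, j) \<in> used_edges T"
    proof -
      obtain u where u: "u \<in> t_inputs T" "j = t_label T (t_step T (the_decision T i) u)"
        using used unfolding used_edges_def by auto
      have st: "(i, 0) \<in> t_states (realization A)" using i by simp
      \<comment> \<open>The same transition is computed on both sides; preservation of labels then
        shows that the destination \<open>?k\<close> is \<open>j\<close>.\<close>
      let ?k = "dlsl_next A i u"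
      have eq: "t_step T (the_decision T i) u = \<phi> (realization_entry A i ?k)"
        using step[OF st, of u] u(1) inp dec[OF i] unfolding realization_entry_def by (simp add: Let_def)
      have "(i, ?k) \<in> d_edges A" using dlsl_next_edge[OF A i] u(1) inp by simp
      then have "realization_entry A i ?k \<in> t_states (realization A)"
        using D unfolding realization_entry_def by auto
      from lab[OF this] have "?k = j" using u(2) eq unfolding realization_entry_def by simp
      then show ?thesis using eq decision_step(2)[OF ec _ u(1), of i] i vis u(2) by simp
    qed
    then have entry: "entry_of E T e i j = \<phi> (j, d_entry A i j)"
      using h unfolding realization_entry_def by auto
    have "hold_dist T j (\<phi> (j, d_entry A i j)) (the_decision T j) = d_entry A i j"
    proof (rule hold_dist_eqI)
      show "decision_state T (the_decision T j)"
        using path_fiber_the_decision(2)[OF pf] j vis by simp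
      \<comment> \<open>Counting down from the entry phase is a walk of exactly that length, and
        \<phi> carries it into the hold graph of \<open>T\<close>.\<close>
      have "(\<phi> (j, Suc k), \<phi> (j, k)) \<in> hold_arcs T j" if "k < d_entry A i j" for k
      proof -
        have "Suc k \<le> d_dur A j - 1" using that le by simp
        then have "((j, Suc k), (j, k)) \<in> hold_arcs (realization A) j"
          using realization_holds_to_pred[OF j] realization_Fib[OF j]
          unfolding hold_arcs_eq[OF neA] by auto
        then show ?thesis unfolding unpointed_iso_hold_arcs[OF iso G neA]
          by (auto intro!: image_eqI)
      qed
      then show "(\<phi> (j, d_entry A i j), the_decision T j) \<in> hold_arcs T j ^^ d_entry A i j"
        unfolding dec[OF j] by (rule relpow_chain[of "d_entry A i j" "\<lambda>k. \<phi> (j, k)"])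
    qed
    then show ?thesis using entry by simp
  qed
qed

text \<open>From left to right the witness is the reconstruction. From right to left
  \<open>E\<close> is \<open>d_edges A\<close>, and the designated entries are the images of
  \<open>realization_entry A\<close> under the isomorphism.\<close>

lemma ec_path_fiber_iff_realization:
  fixes T :: "('q, 'u, 's) transducer"
  shows "((\<exists>E e. ec_path_fiber E T e) \<and> starts_at_fiber_head T) \<longleftrightarrow>
    (\<exists>A :: ('s, 's, 'u) dlsl.
       edge_entry_dlsl A \<and> non_absorbing A \<and> isomorphic (realization A) T)"
proof
  assume "(\<exists>E e. ec_path_fiber E T e) \<and> starts_at_fiber_head T"
  then obtain E e where ec: "ec_path_fiber E T e" and head: "starts_at_fiber_head T" by blast
  have "isomorphic (realization (reconstruct E T e)) T"
    using reconstruct_iso[OF ec] head unfolding isomorphic_def by blast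
  then show "\<exists>A :: ('s, 's, 'u) dlsl.
      edge_entry_dlsl A \<and> non_absorbing A \<and> isomorphic (realization A) T"
    using reconstruct_edge_entry_dlsl[OF ec] reconstruct_non_absorbing[OF ec] by blast
next
  assume "\<exists>A :: ('s, 's, 'u) dlsl.
      edge_entry_dlsl A \<and> non_absorbing A \<and> isomorphic (realization A) T"
  then obtain A :: "('s, 's, 'u) dlsl" and \<phi> where A: "edge_entry_dlsl A" "non_absorbing A"
    and iso: "transducer_iso \<phi> (realization A) T"
    unfolding isomorphic_def by blast
  have u: "unpointed_iso \<phi> (realization A) T"
    and init: "\<phi> (t_init (realization A)) = t_init T"
    using iso unfolding transducer_iso_def by auto
  have ec: "ec_path_fiber (d_edges A) (realization A) (realization_entry A)"
    using realization_ec_path_fiber_iff A by blast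
  then have G: "graph_respecting (d_edges A) (realization A)" and pf: "path_fiber (realization A)"
    unfolding ec_path_fiber_def by auto
  have "t_init (realization A) \<in> t_states (realization A)"
    using G unfolding graph_respecting_def by blast
  then have "t_init T \<in> t_states T"
    using u init unfolding unpointed_iso_def by (metis bij_betwE)
  then have "\<exists>E e. ec_path_fiber E T e" using unpointed_iso_ec_path_fiber[OF u ec] by blast
  moreover have "starts_at_fiber_head T"
    by (rule transducer_iso_starts_at_fiber_head[OF iso G path_fiber_inputs_nonempty[OF G pf]
          realization_starts_at_fiber_head[OF A]])
  ultimately show "(\<exists>E e. ec_path_fiber E T e) \<and> starts_at_fiber_head T" by blast
qed

text \<open>The reconstruction labels visible states by themselves, which is why the existential
  uses label type \<open>'s\<close>; the universally quantified systems may use any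
  \<open>'l\<close>. Parameters are compared along unpointed isomorphisms, so uniqueness also covers
  transducers that do not start at the head of a fiber.\<close>

theorem theorem7p3:
  fixes T :: "('q, 'u, 's) transducer"
  shows
    "(((\<exists>E e. ec_path_fiber E T e) \<and> starts_at_fiber_head T) \<longleftrightarrow>
        (\<exists>A :: ('s, 's, 'u) dlsl.
           edge_entry_dlsl A \<and> non_absorbing A \<and> isomorphic (realization A) T))
     \<and>
     (\<forall>A :: ('s, 'l, 'u) dlsl. edge_entry_dlsl A \<longrightarrow>
        graph_respecting (d_edges A) (realization A) \<and>
        (non_absorbing A \<longleftrightarrow> ec_path_fiber (d_edges A) (realization A) (realization_entry A)) \<and>
        (non_absorbing A \<longrightarrow> starts_at_fiber_head (realization A)))
     \<and>
     (\<forall>E e. ec_path_fiber E T e \<longrightarrow>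
        edge_entry_dlsl (reconstruct E T e) \<and>
        non_absorbing (reconstruct E T e) \<and>
        (\<exists>\<phi>. unpointed_iso \<phi> (realization (reconstruct E T e)) T \<and>
             (\<forall>(i, j) \<in> d_edges (reconstruct E T e).
                \<phi> (realization_entry (reconstruct E T e) i j) = entry_of E T e i j) \<and>
             (transducer_iso \<phi> (realization (reconstruct E T e)) T \<longleftrightarrow> starts_at_fiber_head T)) \<and>
        (\<forall>(A :: ('s, 'l, 'u) dlsl) \<phi>.
           edge_entry_dlsl A \<and> unpointed_iso \<phi> (realization A) T \<longrightarrow>
             (\<forall>i \<in> t_visible T. d_dur A i = card (Fib T i)) \<and>
             (\<forall>(i, j) \<in> d_edges A.
                (i, j) \<in> used_edges T \<or> \<phi> (realization_entry A i j) = entry_of E T e i j \<longrightarrow>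
                  d_entry A i j = hold_dist T j (entry_of E T e i j) (the_decision T j))))"
proof (intro conjI)
  show "((\<exists>E e. ec_path_fiber E T e) \<and> starts_at_fiber_head T) \<longleftrightarrow>
      (\<exists>A :: ('s, 's, 'u) dlsl.
         edge_entry_dlsl A \<and> non_absorbing A \<and> isomorphic (realization A) T)"
    by (rule ec_path_fiber_iff_realization)
  show "\<forall>A :: ('s, 'l, 'u) dlsl. edge_entry_dlsl A \<longrightarrow>
      graph_respecting (d_edges A) (realization A) \<and>
      (non_absorbing A \<longleftrightarrow> ec_path_fiber (d_edges A) (realization A) (realization_entry A)) \<and>
      (non_absorbing A \<longrightarrow> starts_at_fiber_head (realization A))"
    by (simp add: graph_respecting_realization realization_ec_path_fiber_iff
        realization_starts_at_fiber_head)
qed (intro allI impI conjI reconstruct_edge_entry_dlsl reconstruct_non_absorbing reconstruct_iso,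
    assumption+, (elim conjE, intro ballI,
      erule (3) realization_iso_parameters(1)), elim conjE, clarify,
      erule (4) realization_iso_parameters(2))

end
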